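(* Let $p$ be a prime and $d\geq 2$ an integer. Then there exist integers $k$ and $M$ such that $M\geq \eta(\mathbb{Z}_p^d)$, every sequence of length $M$ in $\mathbb{Z}_p^d$ contains at least $k$ pairwise disjoint zero-sum subsequences, and $M\leq p^{d-1}+pk$.
   Context: $\mathbb{Z}_p=\mathbb{Z}/p\mathbb{Z}$. A zero-sum subsequence of a sequence $g_1,\dots,g_m$ is a nonempty set of indices whose terms sum to $0$; subsequences are disjoint if their index sets are disjoint. $\eta(G)$ is the least integer $t$ such that every sequence of length $t$ in $G$ contains a zero-sum subsequence of length at most $\exp(G)$. *)

theory Defs
  imports "HOL-Algebra.FiniteProduct" "HOL-Algebra.Product_Groups" "HOL-Computational_Algebra.Primes"
begin

text \<open>
  Abelian groups are rendered by the multiplicative structures of HOL-Algebra, so that the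
  ``sum'' of a family of elements is \<^const>\<open>finprod\<close> and the neutral element ``0'' is \<open>\<one>\<^bsub>G\<^esub>\<close>.
  The operation of \<^term>\<open>integer_mod_group p\<close> is addition modulo \<^term>\<open>p\<close>.
\<close>

definition Zp_power :: "nat \<Rightarrow> nat \<Rightarrow> (nat \<Rightarrow> int) monoid" where
  "Zp_power p d = product_group {..<d} (\<lambda>_. integer_mod_group p)"

definition group_exp :: "('a, 'b) monoid_scheme \<Rightarrow> nat" where
  "group_exp G = (LEAST n. n > 0 \<and> (\<forall>x\<in>carrier G. x [^]\<^bsub>G\<^esub> n = \<one>\<^bsub>G\<^esub>))"

text \<open>
  A sequence in \<^term>\<open>G\<close> is a list with entries in the carrier; a subsequence is identified with
  its set of positions, so that repeated terms are kept apart.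
\<close>

definition zero_sum_subseq :: "('a, 'b) monoid_scheme \<Rightarrow> 'a list \<Rightarrow> nat set \<Rightarrow> bool" where
  "zero_sum_subseq G xs I \<longleftrightarrow>
     I \<noteq> {} \<and> I \<subseteq> {..<length xs} \<and> finprod G (\<lambda>i. xs ! i) I = \<one>\<^bsub>G\<^esub>"

definition eta :: "('a, 'b) monoid_scheme \<Rightarrow> nat" where
  "eta G = (LEAST t. \<forall>xs. set xs \<subseteq> carrier G \<and> length xs = t \<longrightarrow>
     (\<exists>I. zero_sum_subseq G xs I \<and> card I \<le> group_exp G))"

definition has_disjoint_zero_sum_subseqs ::
    "('a, 'b) monoid_scheme \<Rightarrow> 'a list \<Rightarrow> nat \<Rightarrow> bool" where
  "has_disjoint_zero_sum_subseqs G xs k \<longleftrightarrow>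
     (\<exists>F. (\<forall>I\<in>F. zero_sum_subseq G xs I) \<and> pairwise disjnt F \<and> finite F \<and> card F \<ge> k)"

lemma comm_group_Zp_power: "comm_group (Zp_power p d)"
  unfolding Zp_power_def by (rule group.group_comm_groupI) (auto simp: add.commute fun_eq_iff)

lemma pow_Zp_power: "x \<in> carrier (Zp_power p d) \<Longrightarrow> x [^]\<^bsub>Zp_power p d\<^esub> (n::nat) = (\<lambda>i\<in>{..<d}. (int n * x i) mod int p)"
  by (induction n) (auto simp: Zp_power_def nat_pow_def algebra_simps mod_add_right_eq fun_eq_iff)

lemma group_exp_Zp_power:
  assumes "p > 1" "d > 0" shows "group_exp (Zp_power p d) = p"
  unfolding group_exp_def
proof (rule Least_equality)
  show "0 < p \<and> (\<forall>x\<in>carrier (Zp_power p d). x [^]\<^bsub>Zp_power p d\<^esub> p = \<one>\<^bsub>Zp_power p d\<^esub>)"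
    using assms by (auto simp: pow_Zp_power) (auto simp: Zp_power_def)
  fix n :: nat assume a: "0 < n \<and> (\<forall>x\<in>carrier (Zp_power p d). x [^]\<^bsub>Zp_power p d\<^esub> n = \<one>\<^bsub>Zp_power p d\<^esub>)"
  let ?x = "\<lambda>i\<in>{..<d}. 1::int"
  have c: "?x \<in> carrier (Zp_power p d)" using assms by (auto simp: Zp_power_def carrier_integer_mod_group)
  have "(\<lambda>i\<in>{..<d}. (int n * ?x i) mod int p) = (\<lambda>i\<in>{..<d}. 0)"
    using a c pow_Zp_power[OF c, of n] by (simp add: Zp_power_def)
  from fun_cong[OF this, of 0] have "int n mod int p = 0" using assms by simp
  thus "p \<le> n" using a by (metis dvd_imp_le mod_0_imp_dvd int_dvd_int_iff)
qed

end

(*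
  A long sequence contains some element g very often. The space is covered by
  (p^(d-1) - 1)/(p - 1) planes containing a fixed line through g. Distribute the terms different
  from g among these planes, and fill up the part in each plane with copies of g to a length
  p k_i + p - 1. Every sequence of this length in Z_p^2 has k_i disjoint zero-sum subsequences:
  eta(Z_p^2) = 3p - 2 and D(Z_p^2) = 2p - 1, which follow from Olson's theorem on D(Z_p^r). Hence
  each plane wastes p - 1 terms, p^(d-1) - 1 in total, and p copies of g form a zero-sum
  subsequence by themselves.
*)
theory Submission
  imports Defs "HOL-Number_Theory.Residues"
begin

section \<open>Zero-sum sets of integer vectors modulo a prime\<close>

text \<open>Expanding the product over all subsets of \<open>K\<close>, the term of \<open>K\<close>
  itself cancels. Every remaining term has fewer factors \<open>u k\<close>, which is how a
  difference lowers the degree.\<close>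

lemma prod_add_minus_prod:
  fixes u t :: "'k \<Rightarrow> 'b::comm_ring_1"
  assumes "finite K"
  shows "(\<Prod>k\<in>K. u k + t k) - (\<Prod>k\<in>K. u k) =
    (\<Sum>B\<in>{B. B \<subset> K}. (\<Prod>k\<in>K - B. t k) * (\<Prod>k\<in>B. u k))"
proof -
  have "Pow K = insert K {B. B \<subset> K}"
    by auto
  moreover have "finite {B. B \<subset> K}"
    using assms by (auto intro: finite_subset[of _ "Pow K"])
  ultimately show ?thesis
    by (simp add: prod_add[OF assms] mult.commute)
qed

text \<open>Taking the difference in one index variable lowers the degree of the product.\<close>

lemma alternating_sum_prod_affine_eq_0:
  fixes c :: "'k \<Rightarrow> int" and l :: "'k \<Rightarrow> 'i \<Rightarrow> int"
  assumes "finite A" "finite K" "card K < card A"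
  shows "(\<Sum>I\<in>Pow A. (-1) ^ card I * (\<Prod>k\<in>K. c k + (\<Sum>i\<in>I. l k i))) = 0"
  using assms
proof (induction A arbitrary: K c rule: finite_induct)
  case empty
  then show ?case by simp
next
  case (insert a A)
  let ?u = "\<lambda>I k. c k + (\<Sum>i\<in>I. l k i)"
  have nin: "a \<notin> I" "finite I" if "I \<in> Pow A" for I
    using that insert.hyps finite_subset by auto
  have inj: "inj_on (insert a) (Pow A)"
    using insert.hyps by (auto simp: inj_on_def)
  have disj: "Pow A \<inter> insert a ` Pow A = {}"
    using insert.hyps by auto
  have "(\<Sum>I\<in>Pow (insert a A). (-1) ^ card I * prod (?u I) K) =
      (\<Sum>I\<in>Pow A. (-1) ^ card I * prod (?u I) K) +
      (\<Sum>I\<in>Pow A. (-1) ^ card (insert a I) * prod (?u (insert a I)) K)"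
    unfolding Pow_insert using insert.hyps disj inj
    by (subst sum.union_disjoint) (auto simp: sum.reindex)
  \<comment> \<open>Adjoining \<open>a\<close> flips the sign, so the subsets with and without
    \<open>a\<close> pair up into differences.\<close>
  also have "\<dots> = - (\<Sum>I\<in>Pow A. (-1) ^ card I * (prod (?u (insert a I)) K - prod (?u I) K))"
    by (simp add: nin sum_subtractf right_diff_distrib sum_negf)
  also have "(\<Sum>I\<in>Pow A. (-1) ^ card I * (prod (?u (insert a I)) K - prod (?u I) K)) =
      (\<Sum>I\<in>Pow A. (-1) ^ card I *
        (\<Sum>B\<in>{B. B \<subset> K}. (\<Prod>k\<in>K - B. l k a) * (\<Prod>k\<in>B. ?u I k)))"
  proof (intro sum.cong refl arg_cong2[where f = "(*)"])
    fix I assume I: "I \<in> Pow A"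
    have "prod (?u (insert a I)) K = (\<Prod>k\<in>K. ?u I k + l k a)"
      using nin[OF I] by (intro prod.cong) auto
    then show "prod (?u (insert a I)) K - prod (?u I) K =
        (\<Sum>B\<in>{B. B \<subset> K}. (\<Prod>k\<in>K - B. l k a) * (\<Prod>k\<in>B. ?u I k))"
      using prod_add_minus_prod[OF insert.prems(1)] by simp
  qed
  also have "\<dots> = (\<Sum>B\<in>{B. B \<subset> K}. (\<Prod>k\<in>K - B. l k a) *
      (\<Sum>I\<in>Pow A. (-1) ^ card I * (\<Prod>k\<in>B. ?u I k)))"
    unfolding sum_distrib_left by (subst sum.swap) (simp add: mult_ac)
  also have "\<dots> = 0"
  proof (intro sum.neutral ballI)
    \<comment> \<open>\<open>card K\<close> is at most \<open>card A\<close>, so a proper subset of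
      \<open>K\<close> is small enough for the induction hypothesis.\<close>
    fix B assume "B \<in> {B. B \<subset> K}"
    then have "finite B" "card B < card A"
      using insert.prems insert.hyps psubset_card_mono[of K B] finite_subset[of B K] by auto
    from insert.IH[OF this, of c]
    show "(\<Prod>k\<in>K - B. l k a) * (\<Sum>I\<in>Pow A. (-1) ^ card I * (\<Prod>k\<in>B. ?u I k)) = 0"
      by simp
  qed
  finally show ?case by simp
qed

lemma fermat_int:
  fixes a :: int
  assumes "prime p" "\<not> int p dvd a"
  shows "int p dvd 1 - a ^ (p - 1)"
proof -
  have p: "p > 0"
    using assms(1) prime_gt_0_nat by blast
  define b where "b = nat (a mod int p)"
  have b: "int b = a mod int p"
    using p by (simp add: b_def)
  have "\<not> p dvd b"
    using assms(2) b by (metis dvd_mod_iff dvd_refl int_dvd_int_iff)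
  then have "[b ^ (p - 1) = 1] (mod p)"
    using assms(1) fermat_theorem by blast
  then have "[int b ^ (p - 1) = 1] (mod int p)"
    by (metis cong_int_iff of_nat_1 of_nat_power)
  then have "[a ^ (p - 1) = 1] (mod int p)"
    unfolding b by (simp add: cong_def power_mod)
  then show ?thesis
    by (metis cong_iff_dvd_diff cong_sym)
qed

text \<open>The bound in Olson's theorem on Davenport constants. Modulo \<open>p\<close>, the
  function \<open>P\<close> in the proof is the indicator of the zero-sum sets, yet its degree is too small
  for its alternating sum over all subsets of \<open>A\<close> not to vanish.\<close>

theorem olson_elementary:
  fixes a :: "'j \<Rightarrow> 'i \<Rightarrow> int"
  assumes p: "prime p" and A: "finite A" and J: "finite J"
    and card: "card A > card J * (p - 1)"
  shows "\<exists>I\<subseteq>A. I \<noteq> {} \<and> (\<forall>j\<in>J. int p dvd (\<Sum>i\<in>I. a j i))"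
proof (rule ccontr)
  assume neg: "\<not> ?thesis"
  define s where "s j I = (\<Sum>i\<in>I. a j i)" for j I
  define P where "P I = (\<Prod>j\<in>J. 1 - s j I ^ (p - 1))" for I
  have p2: "p \<ge> 2"
    using p prime_ge_2_nat by blast
  \<comment> \<open>Expanding \<open>P\<close> gives products of at most
    \<open>card J * (p - 1)\<close> linear forms, fewer than \<open>card A\<close>, so each
    alternating sum vanishes.\<close>
  have "(\<Sum>I\<in>Pow A. (-1) ^ card I * P I) =
      (\<Sum>I\<in>Pow A. (-1) ^ card I * (\<Sum>B\<in>Pow J. (-1) ^ card B * (\<Prod>j\<in>B. s j I ^ (p - 1))))"
  proof (intro sum.cong refl arg_cong2[where f = "(*)"])
    fix I
    show "P I = (\<Sum>B\<in>Pow J. (-1) ^ card B * (\<Prod>j\<in>B. s j I ^ (p - 1)))"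
      using prod_add[OF J, of "\<lambda>j. - (s j I ^ (p - 1))" "\<lambda>_. 1"]
      by (simp add: P_def prod_uminus)
  qed
  also have "\<dots> = (\<Sum>B\<in>Pow J. (-1) ^ card B *
      (\<Sum>I\<in>Pow A. (-1) ^ card I * (\<Prod>j\<in>B. s j I ^ (p - 1))))"
    unfolding sum_distrib_left by (subst sum.swap) (simp add: mult_ac)
  also have "\<dots> = 0"
  proof (intro sum.neutral ballI)
    fix B assume "B \<in> Pow J"
    then have B: "finite B" "card B \<le> card J"
      using J by (auto intro: finite_subset card_mono)
    then have "card B * (p - 1) < card A"
      using card mult_le_mono1 le_less_trans by blast
    \<comment> \<open>The pairs repeat each form \<open>s j\<close> exactly \<open>p - 1\<close>
      times, which turns the powers into a product of linear forms.\<close>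
    then have "card (B \<times> {..<p - 1}) < card A"
      by (simp add: card_cartesian_product)
    from alternating_sum_prod_affine_eq_0[OF A _ this, of "\<lambda>_. 0" "\<lambda>k. a (fst k)"]
    have "(\<Sum>I\<in>Pow A. (-1) ^ card I * (\<Prod>k\<in>B \<times> {..<p - 1}. s (fst k) I)) = 0"
      using B by (simp add: s_def)
    moreover have "(\<Prod>k\<in>B \<times> {..<p - 1}. s (fst k) I) = (\<Prod>j\<in>B. s j I ^ (p - 1))" for I
      using prod.cartesian_product[of "\<lambda>j _. s j I" "{..<p - 1}" B]
      by (simp add: case_prod_beta)
    ultimately show "(-1) ^ card B *
        (\<Sum>I\<in>Pow A. (-1) ^ card I * (\<Prod>j\<in>B. s j I ^ (p - 1))) = 0"
      by simp
  qed
  finally have 0: "(\<Sum>I\<in>Pow A. (-1) ^ card I * P I) = 0" .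
  \<comment> \<open>Some coordinate sum of a nonempty \<open>I\<close> is nonzero modulo
    \<open>p\<close>; by Fermat its factor in \<open>P I\<close> vanishes modulo
    \<open>p\<close>.\<close>
  have "int p dvd (-1) ^ card I * P I" if "I \<in> Pow A - {{}}" for I
  proof -
    from neg that obtain j where j: "j \<in> J" "\<not> int p dvd s j I"
      unfolding s_def by auto
    have "1 - s j I ^ (p - 1) dvd P I"
      unfolding P_def using j J by (intro dvd_prodI) auto
    then show ?thesis
      using fermat_int[OF p j(2)] by (meson dvd_mult dvd_trans)
  qed
  then have "int p dvd (\<Sum>I\<in>Pow A - {{}}. (-1) ^ card I * P I)"
    by (intro dvd_sum)
  moreover have "(\<Sum>I\<in>Pow A. (-1) ^ card I * P I) =
      P {} + (\<Sum>I\<in>Pow A - {{}}. (-1) ^ card I * P I)"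
    using A by (subst sum.remove[of _ "{}"]) auto
  \<comment> \<open>Since \<open>p - 1\<close> is positive, \<open>0 ^ (p - 1)\<close> is 0. Hence
    the total, which is 0, would be 1 modulo \<open>p\<close>.\<close>
  moreover have "P {} = 1"
    using p2 by (simp add: P_def s_def power_0_left)
  ultimately show False
    using 0 p2 by (simp add: add_eq_0_iff)
qed

section \<open>Disjoint zero-sum sets in the plane\<close>

text \<open>The predicate \<open>Z\<close> stays abstract because packings are first found for zero
  sums of plane coordinates and then transferred to zero sums in \<open>d\<close>
  coordinates.\<close>

definition packing :: "('i set \<Rightarrow> bool) \<Rightarrow> 'i set \<Rightarrow> nat \<Rightarrow> bool" where
  "packing Z A k \<longleftrightarrow> (\<exists>F. finite F \<and> card F = k \<and> pairwise disjnt F \<and>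
     (\<forall>I\<in>F. I \<subseteq> A \<and> I \<noteq> {} \<and> Z I))"

lemma packing_0: "packing Z A 0"
  unfolding packing_def by (intro exI[of _ "{}"]) auto

lemma packing_single:
  assumes "I \<subseteq> A" "I \<noteq> {}" "Z I"
  shows "packing Z A 1"
  unfolding packing_def using assms by (intro exI[of _ "{I}"]) auto

lemma packing_Un:
  assumes "packing Z A k" "packing Z B l" "A \<inter> B = {}"
  shows "packing Z (A \<union> B) (k + l)"
proof -
  from assms(1) obtain F where F: "finite F" "card F = k" "pairwise disjnt F"
      "\<And>I. I \<in> F \<Longrightarrow> I \<subseteq> A \<and> I \<noteq> {} \<and> Z I"
    by (auto simp: packing_def)
  from assms(2) obtain F' where F': "finite F'" "card F' = l" "pairwise disjnt F'"
      "\<And>I. I \<in> F' \<Longrightarrow> I \<subseteq> B \<and> I \<noteq> {} \<and> Z I"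
    by (auto simp: packing_def)
  have cross: "disjnt I I'" if "I \<in> F" "I' \<in> F'" for I I'
    using F(4)[OF that(1)] F'(4)[OF that(2)] assms(3) by (auto simp: disjnt_def)
  have "pairwise disjnt (F \<union> F')"
  proof (rule pairwiseI)
    fix I I' assume "I \<in> F \<union> F'" "I' \<in> F \<union> F'" "I \<noteq> I'"
    then show "disjnt I I'"
      using pairwiseD[OF F(3)] pairwiseD[OF F'(3)] cross disjnt_sym by blast
  qed
  \<comment> \<open>Members are nonempty, so a common member would have to be disjoint from
    itself.\<close>
  moreover have "F \<inter> F' = {}"
  proof (rule equals0I)
    fix I assume "I \<in> F \<inter> F'"
    then show False
      using cross[of I I] F(4)[of I] by simp
  qed
  then have "card (F \<union> F') = k + l"
    using F F' by (simp add: card_Un_disjoint)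
  moreover have "I \<subseteq> A \<union> B \<and> I \<noteq> {} \<and> Z I" if "I \<in> F \<union> F'" for I
    using that F(4)[of I] F'(4)[of I] by blast
  ultimately show ?thesis
    unfolding packing_def using F(1) F'(1) by (intro exI[of _ "F \<union> F'"]) simp
qed

text \<open>The implication between the predicates is asked only for subsets of \<open>A\<close>,
  since plane coordinates describe only the terms lying in one plane.\<close>

lemma packing_mono:
  assumes "packing Z A k" "A \<subseteq> B" "l \<le> k"
    and "\<And>I. I \<subseteq> A \<Longrightarrow> Z I \<Longrightarrow> Z' I"
  shows "packing Z' B l"
proof -
  from assms(1) obtain F where F: "finite F" "card F = k" "pairwise disjnt F"
      "\<forall>I\<in>F. I \<subseteq> A \<and> I \<noteq> {} \<and> Z I"
    unfolding packing_def by blast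
  obtain F' where F': "F' \<subseteq> F" "card F' = l"
    using F(2) assms(3) obtain_subset_with_card_n[of l F] by blast
  show ?thesis
    unfolding packing_def
  proof (intro exI[of _ F'] conjI ballI)
    show "finite F'" "pairwise disjnt F'"
      using F F'(1) by (auto intro: finite_subset pairwise_subset)
    fix I assume "I \<in> F'"
    then have "I \<subseteq> A" "I \<noteq> {}" "Z I"
      using F F'(1) by blast+
    then show "I \<subseteq> B" "I \<noteq> {}" "Z' I"
      using assms(2,4) by blast+
  qed (rule F'(2))
qed

abbreviation plane_zero_sum :: "nat \<Rightarrow> ('i \<Rightarrow> int) \<Rightarrow> ('i \<Rightarrow> int) \<Rightarrow> 'i set \<Rightarrow> bool" where
  "plane_zero_sum p a b I \<equiv> int p dvd sum a I \<and> int p dvd sum b I"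

text \<open>This is the bound 2p - 1 for the Davenport constant of the plane: Olson's bound with two
  coordinates.\<close>

lemma plane_zero_sum_exists:
  assumes "prime p" "finite A" "card A > 2 * (p - 1)"
  shows "\<exists>I\<subseteq>A. I \<noteq> {} \<and> plane_zero_sum p a b I"
  using olson_elementary[OF assms(1,2), of "{0, 1::nat}" "\<lambda>j. if j = 0 then a else b"] assms(3)
  by auto

text \<open>A constant third coordinate forces the zero-sum set to have \<open>p\<close> or \<open>2p\<close> elements, and
  in the latter case it splits into two zero-sum sets.\<close>

lemma plane_short_zero_sum_exists:
  assumes p: "prime p" and A: "finite A" and card: "card A > 3 * (p - 1)"
  shows "\<exists>I\<subseteq>A. I \<noteq> {} \<and> card I \<le> p \<and> plane_zero_sum p a b I"
proof -
  have p2: "p \<ge> 2"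
    using p prime_ge_2_nat by blast
  \<comment> \<open>The size 3p - 2 suffices for Olson's bound in three coordinates and is below 3p,
    which excludes larger multiples of \<open>p\<close>.\<close>
  obtain B where B: "B \<subseteq> A" "card B = 3 * (p - 1) + 1"
    using card by (metis Suc_eq_plus1 Suc_leI obtain_subset_with_card_n)
  then have finB: "finite B"
    using A finite_subset by blast
  obtain I where I: "I \<subseteq> B" "I \<noteq> {}" "plane_zero_sum p a b I" "int p dvd int (card I)"
    using olson_elementary[OF p finB, of "{0, 1, 2::nat}"
        "\<lambda>j. if j = 0 then a else if j = 1 then b else (\<lambda>_. 1)"] B(2)
    by auto
  have finI: "finite I"
    using I finB finite_subset by blast
  have "card I < 3 * p"
    using card_mono[OF finB I(1)] B(2) p2 by auto
  obtain m where m: "card I = p * m"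
    using I(4) by (auto simp: int_dvd_int_iff)
  then have "m < 3"
    using \<open>card I < 3 * p\<close> p2 by (simp add: mult.commute)
  show ?thesis
  proof (cases "m \<le> 1")
    case True
    then have "card I \<le> p"
      using m mult_le_mono2[of m 1 p] by simp
    then show ?thesis
      using I B by blast
  next
    case False
    with \<open>m < 3\<close> m have cI: "card I = 2 * p"
      by (simp add: numeral_eq_Suc less_Suc_eq)
    \<comment> \<open>Without \<open>x\<close> there are still 2p - 1 elements, and a zero-sum set
      avoiding \<open>x\<close> has a nonempty complement in \<open>I\<close>.\<close>
    obtain x where x: "x \<in> I"
      using I by blast
    have "card (I - {x}) > 2 * (p - 1)"
      using x cI p2 finI by simp
    then obtain K where K: "K \<subseteq> I - {x}" "K \<noteq> {}" "plane_zero_sum p a b K"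
      using plane_zero_sum_exists[OF p] finI by (metis finite_Diff)
    have KI: "K \<subseteq> I" "I - K \<noteq> {}"
      using K x by auto
    have "sum f (I - K) = sum f I - sum f K" for f :: "'a \<Rightarrow> int"
      using KI finI by (intro sum_diff)
    then have "plane_zero_sum p a b (I - K)"
      using I(3) K(3) by simp
    moreover have "card K + card (I - K) = 2 * p"
      using cI KI finI by (metis card_Diff_subset card_mono finite_subset le_add_diff_inverse)
    then have "card K \<le> p \<or> card (I - K) \<le> p"
      by linarith
    ultimately show ?thesis
      using K KI I B by (metis Diff_subset order_trans)
  qed
qed

text \<open>While at least two sets are wanted, 3p - 1 elements are available and a short zero-sum
  set costs at most \<open>p\<close> of them. For the last set 2p - 1 elements remain, enough for a
  zero-sum set of any length.\<close>

lemma plane_packing: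
  assumes p: "prime p" and "finite A" "card A \<ge> p * k + (p - 1)"
  shows "packing (plane_zero_sum p a b) A k"
  using assms(2,3)
proof (induction k arbitrary: A)
  case 0
  show ?case by (rule packing_0)
next
  case (Suc k)
  have p2: "p \<ge> 2"
    using p prime_ge_2_nat by blast
  show ?case
  proof (cases "k = 0")
    case True
    then have "card A > 2 * (p - 1)"
      using Suc.prems p2 by simp
    then obtain I where "I \<subseteq> A" "I \<noteq> {}" "plane_zero_sum p a b I"
      using plane_zero_sum_exists[OF p Suc.prems(1)] by blast
    from packing_single[of I A "plane_zero_sum p a b", OF this] show ?thesis
      using True by simp
  next
    case False
    then have "p * Suc k \<ge> p * 2"
      by (intro mult_le_mono2) simp
    then have "card A > 3 * (p - 1)"
      using Suc.prems p2 by linarith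
    then obtain I where I: "I \<subseteq> A" "I \<noteq> {}" "card I \<le> p" "plane_zero_sum p a b I"
      using plane_short_zero_sum_exists[OF p Suc.prems(1)] by blast
    have "card (A - I) = card A - card I"
      using I Suc.prems by (meson card_Diff_subset finite_subset)
    then have "card (A - I) \<ge> p * k + (p - 1)"
      using Suc.prems I by simp
    then have "packing (plane_zero_sum p a b) (A - I) k"
      using Suc by simp
    from packing_Un[OF packing_single[of I I "plane_zero_sum p a b"] this] I show ?thesis
      by (simp add: Un_absorb1)
  qed
qed

section \<open>Packings from several planes sharing one repeated term\<close>

lemma packing_copies:
  assumes "finite G" "card G \<ge> p * n" "p > 0"
    and "\<And>X. X \<subseteq> G \<Longrightarrow> card X = p \<Longrightarrow> Z X"
  shows "packing Z G n"
  using assms(1,2,4)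
proof (induction n arbitrary: G)
  case 0
  show ?case by (rule packing_0)
next
  case (Suc n)
  have "p \<le> card G"
    using Suc.prems(2) by simp
  then obtain X where X: "X \<subseteq> G" "card X = p"
    using obtain_subset_with_card_n[of p G] by metis
  then have "X \<noteq> {}"
    using assms(3) by auto
  have "card (G - X) = card G - p"
    using X Suc.prems(1) by (metis card_Diff_subset finite_subset)
  then have "packing Z (G - X) n"
    using Suc.prems by (intro Suc.IH) auto
  from packing_Un[OF packing_single[of X X Z] this] X \<open>X \<noteq> {}\<close> Suc.prems(3) show ?case
    by (simp add: Un_absorb1)
qed

text \<open>Every class \<open>U w\<close> is filled up with elements of the common pool \<open>G\<close> until its size is
  \<open>-1\<close> modulo \<open>p\<close>, so that each class wastes exactly \<open>p - 1\<close> elements.\<close>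

lemma packing_common_pool:
  assumes "finite L" and p: "p > 0"
    and "finite G" "card G \<ge> card L * (p - 1)"
    and copies: "\<And>X. X \<subseteq> G \<Longrightarrow> card X = p \<Longrightarrow> Z X"
    and U: "\<And>w. w \<in> L \<Longrightarrow> finite (U w)" "\<And>w. w \<in> L \<Longrightarrow> U w \<inter> G = {}"
      "\<And>w w'. w \<in> L \<Longrightarrow> w' \<in> L \<Longrightarrow> w \<noteq> w' \<Longrightarrow> U w \<inter> U w' = {}"
    and plane: "\<And>w X k. w \<in> L \<Longrightarrow> X \<subseteq> U w \<union> G \<Longrightarrow> card X = p * k + (p - 1) \<Longrightarrow> packing Z X k"
    and "p * n + card L * (p - 1) \<le> card G + (\<Sum>w\<in>L. card (U w))"
  shows "packing Z (G \<union> (\<Union>w\<in>L. U w)) n"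
  using assms(1,3-)
proof (induction L arbitrary: G n rule: finite_induct)
  case empty
  \<comment> \<open>With no class left the size condition reads \<open>p * n <= card G\<close>, and
    the pool is cut into blocks of \<open>p\<close>.\<close>
  have "packing Z G n"
    using empty by (intro packing_copies[OF _ _ p]) auto
  then show ?case by simp
next
  case (insert w L)
  let ?u = "card (U w)"
  define k where "k = ?u div p"
  \<comment> \<open>The number of pool elements that raises the residue of \<open>?u\<close> to
    \<open>p - 1\<close>.\<close>
  define x where "x = p - 1 - ?u mod p"
  have "?u mod p < p"
    using p by simp
  then have ux: "?u + x = p * k + (p - 1)" "x \<le> p - 1"
    unfolding k_def x_def using mult_div_mod_eq[of p ?u] by linarith+
  have cL: "card (insert w L) = Suc (card L)"
    using insert.hyps by simp
  then have "x + card L * (p - 1) \<le> card G"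
    using insert.prems(2) ux(2) by simp
  then obtain X where X: "X \<subseteq> G" "card X = x" "finite X"
    using obtain_subset_with_card_n[of x G] insert.prems(1) finite_subset
    by (metis add_leD1)
  have cGX: "card (G - X) = card G - x"
    using X by (simp add: card_Diff_subset)
  have UG: "U w \<inter> G = {}" "finite (U w)"
    using insert.prems by simp_all
  then have "card (U w \<union> X) = p * k + (p - 1)"
    using X ux by (subst card_Un_disjoint) auto
  then have 1: "packing Z (U w \<union> X) k"
    using X by (intro insert.prems(7)[of w]) auto
  \<comment> \<open>The truncated difference is harmless: if \<open>k\<close> exceeds
    \<open>n\<close>, the packing of the first class already suffices.\<close>
  have 2: "packing Z (G - X \<union> (\<Union>w\<in>L. U w)) (n - k)"
  proof (rule insert.IH)
    show "card L * (p - 1) \<le> card (G - X)"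
      using cGX \<open>x + card L * (p - 1) \<le> card G\<close> by simp
    have "p * n + Suc (card L) * (p - 1) \<le> card G + (?u + (\<Sum>w\<in>L. card (U w)))"
      using insert.prems(8) insert.hyps by simp
    then have "p * n + (p - 1) + card L * (p - 1) \<le> card G + (?u + (\<Sum>w\<in>L. card (U w)))"
      by simp
    moreover have "p * (n - k) = p * n - p * k"
      by (rule diff_mult_distrib2)
    ultimately show "p * (n - k) + card L * (p - 1) \<le> card (G - X) + (\<Sum>w\<in>L. card (U w))"
      using ux cGX \<open>x + card L * (p - 1) \<le> card G\<close> by linarith
    show "packing Z Y m" if "v \<in> L" "Y \<subseteq> U v \<union> (G - X)" "card Y = p * m + (p - 1)" for v Y m
      using that by (intro insert.prems(7)[of v]) auto
    show "U v \<inter> (G - X) = {}" if "v \<in> L" for v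
      using insert.prems(5)[of v] that by auto
    show "Z Y" if "Y \<subseteq> G - X" "card Y = p" for Y
      using that by (intro insert.prems(3)) auto
  qed (use insert.prems in auto)
  have "U w \<inter> U v = {}" if "v \<in> L" for v
    using that insert.hyps insert.prems(6)[of w v] by auto
  then have "(U w \<union> X) \<inter> (G - X \<union> (\<Union>w\<in>L. U w)) = {}"
    using X UG insert.prems(5) by fastforce
  from packing_mono[OF packing_Un[OF 1 2 this]] show ?case
    using X by (auto simp: subset_iff)
qed

section \<open>Planes through a line\<close>

lemma carrier_Zp_power:
  "p > 0 \<Longrightarrow> carrier (Zp_power p d) = (\<Pi>\<^sub>E i\<in>{..<d}. {0..<int p})"
  by (simp add: Zp_power_def carrier_integer_mod_group)

lemma one_Zp_power: "\<one>\<^bsub>Zp_power p d\<^esub> = (\<lambda>i\<in>{..<d}. 0)"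
  by (simp add: Zp_power_def)

lemma card_carrier_Zp_power: "p > 0 \<Longrightarrow> card (carrier (Zp_power p d)) = p ^ d"
  by (simp add: carrier_Zp_power card_PiE)

lemma finprod_Zp_power:
  assumes "finite I" "\<And>k. k \<in> I \<Longrightarrow> f k \<in> carrier (Zp_power p d)"
  shows "finprod (Zp_power p d) f I = (\<lambda>i\<in>{..<d}. (\<Sum>k\<in>I. f k i) mod int p)"
  using assms
proof (induction I rule: finite_induct)
  case empty
  show ?case
    unfolding comm_monoid.finprod_empty[OF comm_group.axioms(1)[OF comm_group_Zp_power]]
    by (simp add: one_Zp_power)
next
  case (insert k I)
  then have "finprod (Zp_power p d) f (insert k I) =
      f k \<otimes>\<^bsub>Zp_power p d\<^esub> finprod (Zp_power p d) f I"
    by (intro comm_monoid.finprod_insert[OF comm_group.axioms(1)[OF comm_group_Zp_power]]) auto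
  then show ?case
    using insert by (auto simp: Zp_power_def fun_eq_iff mod_add_right_eq)
qed

text \<open>The passage from the group to divisibility of integer coordinate sums, the language of
  Olson's bound and of the packings.\<close>

lemma zero_sum_subseq_Zp_power_iff:
  assumes "set xs \<subseteq> carrier (Zp_power p d)"
  shows "zero_sum_subseq (Zp_power p d) xs I \<longleftrightarrow>
    I \<noteq> {} \<and> I \<subseteq> {..<length xs} \<and> (\<forall>c<d. int p dvd (\<Sum>i\<in>I. (xs ! i) c))"
proof (cases "I \<subseteq> {..<length xs}")
  case True
  then have "finite I" "\<And>k. k \<in> I \<Longrightarrow> xs ! k \<in> carrier (Zp_power p d)"
    using assms by (auto simp: subset_iff intro: finite_subset[of I "{..<length xs}"])
  then have "finprod (Zp_power p d) ((!) xs) I = (\<lambda>c\<in>{..<d}. (\<Sum>i\<in>I. (xs ! i) c) mod int p)"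
    by (rule finprod_Zp_power)
  moreover have "(\<lambda>c\<in>{..<d}. f c) = (\<lambda>c\<in>{..<d}. 0) \<longleftrightarrow> (\<forall>c<d. f c = 0)" for f :: "nat \<Rightarrow> int"
    by (metis lessThan_iff restrict_apply' restrict_ext)
  ultimately show ?thesis
    by (simp only: zero_sum_subseq_def one_Zp_power dvd_eq_mod_eq_0)
qed (simp add: zero_sum_subseq_def)

lemma inverse_mod_prime_exists:
  fixes a :: int
  assumes "prime p" "\<not> int p dvd a"
  obtains b where "[b * a = 1] (mod int p)"
proof -
  have "coprime a (int p)"
    using assms by (metis coprime_commute prime_imp_coprime prime_nat_int_transfer)
  then show ?thesis
    using that cong_solve_coprime_int[of a "int p"] by (metis mult.commute)
qed

text \<open>The representatives are the vectors whose first nonzero coordinate is 1.\<close>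

lemma projective_representatives:
  fixes V :: "(nat \<Rightarrow> int) set"
  assumes p: "prime p" and V: "finite V" "V \<subseteq> (\<Pi>\<^sub>E i\<in>{..<d}. {0..<int p})"
    and nz: "\<And>y. y \<in> V \<Longrightarrow> \<exists>i<d. y i \<noteq> 0"
    and scale: "\<And>y b. y \<in> V \<Longrightarrow> \<not> int p dvd b \<Longrightarrow> (\<lambda>i\<in>{..<d}. b * y i mod int p) \<in> V"
  obtains L where "L \<subseteq> V" "card L * (p - 1) \<le> card V"
    "\<And>y. y \<in> V \<Longrightarrow> \<exists>w\<in>L. \<exists>b. \<forall>i<d. [y i = b * w i] (mod int p)"
proof -
  define f where "f y = (LEAST i. y i \<noteq> 0)" for y :: "nat \<Rightarrow> int"
  \<comment> \<open>Scaling is uncurried so that its injectivity on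
    \<open>{1..<int p} \<times> L\<close> yields the bound on
    \<open>card L * (p - 1)\<close>.\<close>
  define sc where "sc = (\<lambda>(b, y). \<lambda>i\<in>{..<d}. b * y i mod int p)"
  define L where "L = {w \<in> V. w (f w) = 1}"
  have pp: "prime (int p)" "int p > 1"
    using p prime_gt_1_nat by auto
  have rng: "0 \<le> y i" "y i < int p" if "y \<in> V" "i < d" for y i
    using PiE_mem[OF subsetD[OF V(2) that(1)], of i] that(2) by auto
  have dvd0: "int p dvd y i \<longleftrightarrow> y i = 0" if "y \<in> V" "i < d" for y i
    using rng[OF that] by (auto dest: zdvd_imp_le)
  have fd: "f y < d" "y (f y) \<noteq> 0" if "y \<in> V" for y
  proof -
    obtain i where i: "i < d" "y i \<noteq> 0"
      using nz \<open>y \<in> V\<close> by blast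
    show "f y < d"
      using Least_le[of "\<lambda>i. y i \<noteq> 0", OF i(2)] i(1) by (simp add: f_def)
    show "y (f y) \<noteq> 0"
      unfolding f_def using i(2) by (rule LeastI)
  qed
  have sc_f: "f (sc (b, y)) = f y" if "y \<in> V" "\<not> int p dvd b" for b y
    unfolding f_def[of "sc (b, y)"]
  proof (rule Least_equality)
    show "sc (b, y) (f y) \<noteq> 0"
      using fd[OF that(1)] dvd0[OF that(1)] that pp
      by (simp add: sc_def flip: dvd_eq_mod_eq_0) (simp add: prime_dvd_mult_iff)
    fix i assume i: "sc (b, y) i \<noteq> 0"
    show "f y \<le> i"
    proof (rule ccontr)
      assume "\<not> f y \<le> i"
      then have "i < d" "y i = 0"
        using fd[OF that(1)] not_less_Least[of i "\<lambda>i. y i \<noteq> 0"] by (auto simp: f_def)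
      with i show False by (simp add: sc_def)
    qed
  qed
  have unit: "\<not> int p dvd b" if "b \<in> {1..<int p}" for b
    using that by (auto dest: zdvd_imp_le)
  have inj: "inj_on sc ({1..<int p} \<times> L)"
  proof (rule inj_onI, clarify)
    fix b w b' w'
    assume b: "b \<in> {1..<int p}" "b' \<in> {1..<int p}" and w: "w \<in> L" "w' \<in> L"
      and eq: "sc (b, w) = sc (b', w')"
    have wV: "w \<in> V" "w' \<in> V" "w (f w) = 1" "w' (f w') = 1"
      using w by (auto simp: L_def)
    then have "f w = f w'"
      using sc_f unit b eq by metis
    \<comment> \<open>A representative has entry 1 at its leading position, so there the scaled
      vector shows the scalar itself.\<close>
    then have "b mod int p = b' mod int p"
      using fun_cong[OF eq, of "f w"] fd[OF wV(1)] wV by (simp add: sc_def)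
    then have bb: "b = b'"
      using b by simp
    have "w i = w' i" for i
    proof (cases "i < d")
      case True
      then have "[b * w i = b * w' i] (mod int p)"
        using fun_cong[OF eq, of i] bb by (simp add: sc_def cong_def)
      moreover have "coprime b (int p)"
        using unit b pp by (metis coprime_commute prime_imp_coprime)
      ultimately have "[w i = w' i] (mod int p)"
        using cong_mult_lcancel by blast
      then show ?thesis
        using rng[OF wV(1) True] rng[OF wV(2) True] by (simp add: cong_def)
    next
      \<comment> \<open>Beyond the first \<open>d\<close> coordinates both vectors take the default
        value \<open>undefined\<close>.\<close>
      case False
      then show ?thesis
        using PiE_arb[OF subsetD[OF V(2) wV(1)]] PiE_arb[OF subsetD[OF V(2) wV(2)]] by simp
    qed
    with bb show "b = b' \<and> w = w'" by auto
  qed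
  have "sc ` ({1..<int p} \<times> L) \<subseteq> V"
    using scale unit by (auto simp: sc_def L_def)
  then have "card ({1..<int p} \<times> L) \<le> card V"
    using card_inj_on_le[OF inj _ V(1)] by blast
  moreover have "nat (int p - 1) = p - 1"
    by arith
  ultimately have "card L * (p - 1) \<le> card V"
    by (simp add: card_cartesian_product mult.commute)
  moreover have "\<exists>w\<in>L. \<exists>b. \<forall>i<d. [y i = b * w i] (mod int p)" if y: "y \<in> V" for y
  proof -
    \<comment> \<open>Scaling by an inverse of the leading entry gives the representative; the
      leading entry scales it back to \<open>y\<close>.\<close>
    obtain c where c: "[c * y (f y) = 1] (mod int p)"
      using inverse_mod_prime_exists[OF p] fd[OF y] dvd0[OF y] by metis
    have nc: "\<not> int p dvd c"
    proof
      assume "int p dvd c"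
      then have "int p dvd 1"
        using c by (meson cong_dvd_iff dvd_mult2)
      with pp show False by simp
    qed
    have "sc (c, y) \<in> L"
      using scale[OF y nc] sc_f[OF y nc] c fd[OF y] pp by (simp add: L_def sc_def cong_def)
    moreover have "[y i = y (f y) * sc (c, y) i] (mod int p)" if "i < d" for i
    proof -
      have "[y i * 1 = y i * (c * y (f y))] (mod int p)"
        using c by (intro cong_mult cong_refl) (rule cong_sym)
      also have "y i * (c * y (f y)) = y (f y) * (c * y i)"
        by (simp add: mult_ac)
      also have "[y (f y) * (c * y i) = y (f y) * sc (c, y) i] (mod int p)"
        using that by (simp add: sc_def cong_def mod_mult_right_eq)
      finally show ?thesis by simp
    qed
    ultimately show ?thesis by blast
  qed
  ultimately show ?thesis
    using that[of L] by (auto simp: L_def)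
qed

text \<open>The planes, spanned by \<open>h\<close> and some \<open>w \<in> L\<close>, correspond to the points of the projective
  space of the quotient by \<open>h\<close>. The quotient is realised by making one coordinate vanish.\<close>

lemma planes_through_line:
  assumes p: "prime p" and d: "d \<ge> 2" and g: "g \<in> carrier (Zp_power p d)"
  obtains h :: "nat \<Rightarrow> int" and \<gamma> :: int and L :: "(nat \<Rightarrow> int) set" where
    "\<forall>i<d. [g i = \<gamma> * h i] (mod int p)"
    "finite L" "card L * (p - 1) \<le> p ^ (d - 1) - 1"
    "\<And>x. x \<in> carrier (Zp_power p d) \<Longrightarrow>
      \<exists>w\<in>L. \<exists>a b. \<forall>i<d. [x i = a * h i + b * w i] (mod int p)"
proof -
  have p1: "p > 1" and p0: "p > 0"
    using p prime_gt_1_nat[of p] by auto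
  \<comment> \<open>If \<open>g\<close> is nonzero, \<open>h\<close> is \<open>g\<close> scaled to
    have entry 1 at some \<open>j\<close>. For \<open>g = 0\<close> any line will do, here that of
    the all-one vector with \<open>\<gamma> = 0\<close>.\<close>
  have "\<exists>j h \<gamma>. j < d \<and> [h j = 1] (mod int p) \<and> (\<forall>i<d. [g i = \<gamma> * h i] (mod int p))"
  proof (cases "\<exists>j<d. g j \<noteq> 0")
    case True
    then obtain j where j: "j < d" "g j \<noteq> 0" by blast
    have "g j \<in> {0..<int p}"
      using PiE_mem[of g "{..<d}" "\<lambda>_. {0..<int p}" j] g j by (simp add: carrier_Zp_power p0)
    then have "\<not> int p dvd g j"
      using j by (auto dest: zdvd_imp_le)
    then obtain c where c: "[c * g j = 1] (mod int p)"
      using inverse_mod_prime_exists[OF p] by blast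
    have "[g i = g j * (c * g i)] (mod int p)" for i
    proof -
      have "[g i * 1 = g i * (c * g j)] (mod int p)"
        using c by (intro cong_mult cong_refl) (rule cong_sym)
      then show ?thesis by (simp add: mult_ac)
    qed
    then show ?thesis
      using c j by (intro exI[of _ j] exI[of _ "\<lambda>i. c * g i"] exI[of _ "g j"]) auto
  next
    case False
    then show ?thesis
      using d by (intro exI[of _ 0] exI[of _ "\<lambda>_. 1"] exI[of _ 0]) auto
  qed
  then obtain j h \<gamma> where j: "j < d" "[h j = 1] (mod int p)"
    and h: "\<forall>i<d. [g i = \<gamma> * h i] (mod int p)"
    by blast
  \<comment> \<open>As \<open>h j\<close> is 1 modulo \<open>p\<close>, the vectors vanishing at
    \<open>j\<close> form a complement of the line of \<open>h\<close>.\<close>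
  define W where "W = (\<Pi>\<^sub>E i\<in>{..<d}. if i = j then {0} else {0..<int p})"
  define z where "z = (\<lambda>i\<in>{..<d}. 0::int)"
  have finW: "finite W"
    unfolding W_def by (intro finite_PiE) auto
  have "card W = (\<Prod>i\<in>{..<d}. if i = j then 1 else p)"
    unfolding W_def by (subst card_PiE) (auto intro!: prod.cong)
  also have "\<dots> = p ^ (d - 1)"
    using j by (subst prod.remove[of _ j]) auto
  finally have cW: "card W = p ^ (d - 1)" .
  have zW: "z \<in> W"
    using p0 by (auto simp: W_def z_def)
  have cV: "card (W - {z}) = p ^ (d - 1) - 1"
    using cW zW finW by simp
  have W_sub: "W \<subseteq> (\<Pi>\<^sub>E i\<in>{..<d}. {0..<int p})"
    unfolding W_def using p0 by (intro PiE_mono) auto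
  have nz: "\<exists>i<d. y i \<noteq> 0" if "y \<in> W - {z}" for y
  proof (rule ccontr)
    assume "\<not> ?thesis"
    moreover have "y \<in> (\<Pi>\<^sub>E i\<in>{..<d}. {0..<int p})"
      using that W_sub by blast
    ultimately have "y = z"
      by (auto simp: z_def fun_eq_iff PiE_iff extensional_def)
    with that show False by blast
  qed
  have scale: "(\<lambda>i\<in>{..<d}. b * y i mod int p) \<in> W - {z}"
    if y: "y \<in> W - {z}" and b: "\<not> int p dvd b" for y b
  proof -
    obtain i where i: "i < d" "y i \<noteq> 0"
      using nz[OF y] by blast
    moreover have "y i \<in> {0..<int p}"
      using PiE_mem[of y "{..<d}" "\<lambda>_. {0..<int p}" i] y i W_sub by blast
    ultimately have "\<not> int p dvd y i"
      by (auto dest: zdvd_imp_le)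
    then have "b * y i mod int p \<noteq> 0"
      using b p by (simp add: prime_dvd_mult_iff flip: dvd_eq_mod_eq_0)
    then have "(\<lambda>i\<in>{..<d}. b * y i mod int p) \<noteq> z"
      using i by (auto simp: z_def fun_eq_iff)
    moreover have "y j = 0"
      using PiE_mem[of y "{..<d}" "\<lambda>i. if i = j then {0} else {0..<int p}" j] y j(1)
      by (simp add: W_def)
    then have "(\<lambda>i\<in>{..<d}. b * y i mod int p) \<in> W"
      using p0 by (auto simp: W_def)
    ultimately show ?thesis by blast
  qed
  have finV: "finite (W - {z})" and V_sub: "W - {z} \<subseteq> (\<Pi>\<^sub>E i\<in>{..<d}. {0..<int p})"
    using finW W_sub by auto
  obtain L where L: "L \<subseteq> W - {z}" "card L * (p - 1) \<le> card (W - {z})"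
    "\<And>y. y \<in> W - {z} \<Longrightarrow> \<exists>w\<in>L. \<exists>b. \<forall>i<d. [y i = b * w i] (mod int p)"
  proof (rule projective_representatives[OF p finV V_sub])
    show "\<exists>i<d. y i \<noteq> 0" if "y \<in> W - {z}" for y
      using that by (rule nz)
    show "(\<lambda>i\<in>{..<d}. b * y i mod int p) \<in> W - {z}"
      if "y \<in> W - {z}" "\<not> int p dvd b" for y b
      using that by (rule scale)
  qed (rule that)
  \<comment> \<open>Vectors on the line of \<open>h\<close> must also get a plane, so
    \<open>L\<close> has to be nonempty; this uses \<open>d >= 2\<close>.\<close>
  have "p ^ (d - 1) > 1"
    using p1 d by (intro one_less_power) auto
  then have "W - {z} \<noteq> {}"
    using cV by (metis card.empty less_numeral_extra(3) zero_less_diff)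
  then have "L \<noteq> {}"
    using L(3) by blast
  have "\<exists>w\<in>L. \<exists>a b. \<forall>i<d. [x i = a * h i + b * w i] (mod int p)"
    if x: "x \<in> carrier (Zp_power p d)" for x
  proof -
    \<comment> \<open>Subtracting \<open>x j\<close> times \<open>h\<close> projects
      \<open>x\<close> to the complement \<open>W\<close> along the line.\<close>
    define y where "y = (\<lambda>i\<in>{..<d}. (x i - x j * h i) mod int p)"
    have "[x j - x j * h j = x j - x j * 1] (mod int p)"
      using j by (intro cong_diff cong_mult cong_refl)
    then have "y j = 0"
      using j by (simp add: y_def cong_def)
    then have yW: "y \<in> W"
      using p0 by (auto simp: W_def PiE_iff y_def)
    have "\<exists>w\<in>L. \<exists>b. \<forall>i<d. [y i = b * w i] (mod int p)"
    proof (cases "y = z")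
      case True
      obtain w where "w \<in> L" using \<open>L \<noteq> {}\<close> by blast
      then show ?thesis
        using True by (intro bexI[of _ w] exI[of _ 0]) (auto simp: z_def)
    next
      case False
      then show ?thesis
        using L(3) yW by blast
    qed
    then obtain w b where wb: "w \<in> L" "\<forall>i<d. [y i = b * w i] (mod int p)"
      by blast
    have "[x i = x j * h i + b * w i] (mod int p)" if "i < d" for i
    proof -
      have "[x i - x j * h i = b * w i] (mod int p)"
        using wb(2) that by (simp add: y_def cong_def)
      then have "[x j * h i + (x i - x j * h i) = x j * h i + b * w i] (mod int p)"
        by (intro cong_add cong_refl)
      then show ?thesis by simp
    qed
    then show ?thesis using wb(1) by blast
  qed
  moreover have "finite L"
    using L(1) finW finite_subset by blast
  ultimately show ?thesis
    using that[of \<gamma> h L] h L(2) cV by metis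
qed

section \<open>Distributing a long sequence among the planes\<close>

theorem theorem1p4:
  fixes p d :: nat
  assumes "Factorial_Ring.prime p" and "d \<ge> 2"
  shows "\<exists>k M :: nat.
    M \<ge> eta (Zp_power p d) \<and>
    (\<forall>xs. set xs \<subseteq> carrier (Zp_power p d) \<and> length xs = M \<longrightarrow>
       has_disjoint_zero_sum_subseqs (Zp_power p d) xs k) \<and>
    M \<le> p ^ (d - 1) + p * k"
proof -
  \<comment> \<open>So large that \<open>M\<close> is at least \<open>p ^ (d - 1) * p ^ d\<close>;
    by pigeonhole some element then occurs \<open>p ^ (d - 1)\<close> times.\<close>
  define k where "k = p ^ (2 * d)"
  define M where "M = p ^ (d - 1) + p * k"
  let ?G = "Zp_power p d"
  have p: "p > 1" "p > 0"
    using assms(1) prime_gt_1_nat[of p] by auto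
  have card_C: "card (carrier ?G) = p ^ d"
    by (rule card_carrier_Zp_power[OF p(2)])
  then have C: "finite (carrier ?G)" "carrier ?G \<noteq> {}"
    using p card.infinite[of "carrier ?G"] by fastforce+
  have many_copies: "\<exists>g\<in>carrier ?G. card {i\<in>{..<M}. xs ! i = g} \<ge> p ^ (d - 1)"
    if xs: "set xs \<subseteq> carrier ?G" "length xs = M" for xs
  proof -
    have "(!) xs \<in> {..<M} \<rightarrow> carrier ?G"
      using xs by auto
    then obtain g where g: "g \<in> carrier ?G"
      "card ((!) xs -` {g} \<inter> {..<M}) * p ^ d \<ge> M"
      using pigeonhole_card[of "(!) xs" "{..<M}" "carrier ?G"] C card_C by auto
    have "p ^ (d - 1) * p ^ d \<le> p ^ (2 * d)"
      unfolding power_add[symmetric] using p by (intro power_increasing) auto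
    also have "\<dots> \<le> M"
      using p by (simp add: M_def k_def trans_le_add2)
    finally have "p ^ (d - 1) \<le> card ((!) xs -` {g} \<inter> {..<M})"
      using g(2) p by (meson le_trans mult_le_cancel2 zero_less_power)
    also have "(!) xs -` {g} \<inter> {..<M} = {i\<in>{..<M}. xs ! i = g}"
      by auto
    finally show ?thesis using g(1) by blast
  qed
  have copies: "int p dvd (\<Sum>i\<in>X. (xs ! i) c)"
    if "X \<subseteq> {i\<in>{..<M}. xs ! i = g}" "card X = p" for xs g X and c :: nat
  proof -
    have "(\<Sum>i\<in>X. (xs ! i) c) = (\<Sum>i\<in>X. g c)"
      using that by (intro sum.cong) auto
    with that(2) show ?thesis by simp
  qed
  have "eta ?G \<le> M"
    unfolding eta_def
  proof (intro Least_le allI impI, elim conjE)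
    fix xs assume xs: "set xs \<subseteq> carrier ?G" "length xs = M"
    obtain g where g: "card {i\<in>{..<M}. xs ! i = g} \<ge> p ^ (d - 1)"
      using many_copies[OF xs] by blast
    \<comment> \<open>Since \<open>d >= 2\<close>, there are at least \<open>p\<close> copies of
      \<open>g\<close>, and \<open>p\<close> of them form a zero-sum subsequence of length the
      exponent.\<close>
    have "p ^ 1 \<le> p ^ (d - 1)"
      using p assms(2) by (intro power_increasing) auto
    then have "p \<le> card {i\<in>{..<M}. xs ! i = g}"
      using g by (simp only: power_one_right)
    then obtain X where X: "X \<subseteq> {i\<in>{..<M}. xs ! i = g}" "card X = p"
      by (rule obtain_subset_with_card_n)
    then have "zero_sum_subseq ?G xs X"
      using copies[OF X] xs p by (subst zero_sum_subseq_Zp_power_iff) auto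
    moreover have "card X \<le> group_exp ?G"
      using X group_exp_Zp_power[of p d] p assms(2) by simp
    ultimately show "\<exists>I. zero_sum_subseq ?G xs I \<and> card I \<le> group_exp ?G"
      by blast
  qed
  moreover have "has_disjoint_zero_sum_subseqs ?G xs k"
    if xs: "set xs \<subseteq> carrier ?G" "length xs = M" for xs
  proof -
    define Z where "Z I \<longleftrightarrow> (\<forall>c<d. int p dvd (\<Sum>i\<in>I. (xs ! i) c))" for I
    obtain g where g: "g \<in> carrier ?G" "card {i\<in>{..<M}. xs ! i = g} \<ge> p ^ (d - 1)"
      using many_copies[OF xs] by blast
    obtain h \<gamma> L where h: "\<forall>c<d. [g c = \<gamma> * h c] (mod int p)"
      and L: "finite L" "card L * (p - 1) \<le> p ^ (d - 1) - 1"
      and cover: "\<And>x. x \<in> carrier ?G \<Longrightarrow>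
        \<exists>w\<in>L. \<exists>a b. \<forall>c<d. [x c = a * h c + b * w c] (mod int p)"
      by (rule planes_through_line[OF assms g(1)]) (rule that)
    obtain cl where cl: "\<And>x. x \<in> carrier ?G \<Longrightarrow> cl x \<in> L"
      "\<And>x. x \<in> carrier ?G \<Longrightarrow> \<exists>a b. \<forall>c<d. [x c = a * h c + b * cl x c] (mod int p)"
      \<comment> \<open>A vector may lie in several planes; fixing one choice makes the classes
        \<open>U w\<close> disjoint.\<close>
      using bchoice[of "carrier ?G" "\<lambda>x w. w \<in> L \<and>
        (\<exists>a b. \<forall>c<d. [x c = a * h c + b * w c] (mod int p))"] cover by blast
    define G where "G = {i\<in>{..<M}. xs ! i = g}"
    define U where "U w = {i\<in>{..<M}. xs ! i \<noteq> g \<and> cl (xs ! i) = w}" for w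
    have mem: "xs ! i \<in> carrier ?G" if "i < M" for i
      using that xs by auto
    have union: "G \<union> (\<Union>w\<in>L. U w) = {..<M}"
      using cl(1) mem by (auto simp: G_def U_def)
    have "packing Z (G \<union> (\<Union>w\<in>L. U w)) k"
    proof (rule packing_common_pool[OF L(1) p(2)])
      show "Z X" if "X \<subseteq> G" "card X = p" for X
        using copies that unfolding Z_def G_def by blast
      show "card L * (p - 1) \<le> card G"
        using L g by (simp add: G_def)
      have "card {..<M} = card G + card (\<Union>w\<in>L. U w)"
        unfolding union[symmetric] using L by (intro card_Un_disjoint) (auto simp: G_def U_def)
      also have "card (\<Union>w\<in>L. U w) = (\<Sum>w\<in>L. card (U w))"
        using L by (intro card_UN_disjoint) (auto simp: U_def)
      \<comment> \<open>The summand \<open>p ^ (d - 1)\<close> of \<open>M\<close> pays for the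
        \<open>p - 1\<close> terms wasted in each plane.\<close>
      finally show "p * k + card L * (p - 1) \<le> card G + (\<Sum>w\<in>L. card (U w))"
        using L(2) by (simp add: M_def)
      show "packing Z X n"
        if w: "w \<in> L" and X: "X \<subseteq> U w \<union> G" "card X = p * n + (p - 1)" for w X n
      proof -
        have "finite X"
          using X by (rule_tac finite_subset[of _ "U w \<union> G"]) (auto simp: U_def G_def)
        have "\<exists>a b. \<forall>c<d. [(xs ! i) c = a * h c + b * w c] (mod int p)" if i: "i \<in> X" for i
        proof (cases "i \<in> G")
          case True
          \<comment> \<open>The copies of \<open>g\<close> lie on the common line, hence in every
            plane, with second coordinate 0.\<close>
          then show ?thesis
            using h by (intro exI[of _ \<gamma>] exI[of _ 0]) (simp add: G_def)
        next
          case False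
          then have "i < M" "cl (xs ! i) = w"
            using i X by (auto simp: U_def)
          then show ?thesis
            using cl(2)[OF mem] by blast
        qed
        then obtain a b where ab:
          "\<And>i c. i \<in> X \<Longrightarrow> c < d \<Longrightarrow> [(xs ! i) c = a i * h c + b i * w c] (mod int p)"
          by metis
        show ?thesis
        proof (rule packing_mono[OF plane_packing[OF assms(1) \<open>finite X\<close>, where k = n]])
          show "Z I" if I: "I \<subseteq> X" "plane_zero_sum p a b I" for I
            unfolding Z_def
          proof (intro allI impI)
            fix c assume "c < d"
            \<comment> \<open>Modulo \<open>p\<close> each coordinate sum is a combination of the
              two plane sums, so zero sums in the plane are zero sums in all \<open>d\<close>
              coordinates.\<close>
            then have "[(\<Sum>i\<in>I. (xs ! i) c) = (\<Sum>i\<in>I. a i * h c + b i * w c)] (mod int p)"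
              using ab I by (intro cong_sum) auto
            moreover have "(\<Sum>i\<in>I. a i * h c + b i * w c) = sum a I * h c + sum b I * w c"
              by (simp add: sum.distrib sum_distrib_right)
            ultimately show "int p dvd (\<Sum>i\<in>I. (xs ! i) c)"
              using I by (simp add: cong_dvd_iff)
          qed
        qed (use X in auto)
      qed
    qed (auto simp: G_def U_def)
    then obtain F where "finite F" "card F = k" "pairwise disjnt F"
      "\<forall>I\<in>F. I \<subseteq> {..<M} \<and> I \<noteq> {} \<and> Z I"
      unfolding union packing_def by blast
    then show ?thesis
      unfolding has_disjoint_zero_sum_subseqs_def zero_sum_subseq_Zp_power_iff[OF xs(1)]
      using xs(2) by (intro exI[of _ F]) (auto simp: Z_def)
  qed
  ultimately show ?thesis
    by (intro exI[of _ k] exI[of _ M]) (auto simp: M_def)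
qed

end
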